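(* For all compositions $\alpha,\beta$, $$\eta_\alpha\eta_\beta=\sum_{\gamma\in\alpha\,\overline{\overline{\sqcup\!\sqcup}}\,\beta}(-1)^{\mathrm c_2(\gamma)}\eta_{\gamma^+}\qquad\text{and}\qquad \eta^{(q)}_\alpha\eta^{(q)}_\beta=\sum_{\gamma\in\alpha\,\overline{\overline{\sqcup\!\sqcup}}\,\beta}(-1)^{\mathrm c_2(\gamma)}q^{\mathrm c_1(\gamma)}\eta^{(q)}_{\gamma^+}.$$
   Context: A composition is a finite (possibly empty) tuple $\alpha=(\alpha_1,\dots,\alpha_l)$ of positive integers; $\ell(\alpha)=l$. Write $\beta\succeq\alpha$ if $\alpha$ refines $\beta$, i.e. $\beta$ is obtained from $\alpha$ by adding together some adjacent parts. $M_\alpha=\sum_{i_1<\dots<i_l}x_{i_1}^{\alpha_1}\cdots x_{i_l}^{\alpha_l}$ is the monomial quasisymmetric function. The enriched monomial quasisymmetric function is $\eta_\alpha=\sum_{\beta\succeq\alpha}2^{\ell(\beta)}M_\beta$, and the enriched $q$-monomial quasisymmetric function is $\eta^{(q)}_\alpha=\sum_{\beta\succeq\alpha}(q+1)^{\ell(\beta)}M_\beta$ (over $\mathbb C(q)$). Two-way overlapping shuffles. Let $\alpha=(\alpha_1,\dots,\alpha_l)$, $\beta=(\beta_1,\dots,\beta_k)$. A shuffle of $\alpha$ and $\beta$ is a sequence of length $l+k$ obtained by choosing a $k$-element subset $D\subseteq\{1,\dots,l+k\}$, placing $\beta_1,\dots,\beta_k$ in this order in the positions in $D$ and $\alpha_1,\dots,\alpha_l$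 in this order in the other positions. A two-way overlapping shuffle of $\alpha$ and $\beta$ is an expression obtained from such a shuffle by replacing some (possibly none) of the commas inside consecutive pairs of the form $(\alpha_i,\beta_j)$ by the symbol $+_1$ and some (possibly none) of the commas inside consecutive pairs of the form $(\beta_j,\alpha_i)$ by the symbol $+_2$. $\alpha\,\overline{\overline{\sqcup\!\sqcup}}\,\beta$ is the multiset of all two-way overlapping shuffles, one for each choice of $D$ and of the commas to be replaced. For such $\gamma$, $\gamma^+$ is the composition obtained by replacing every $+_1$ and $+_2$ by ordinary addition, and $\mathrm c_1(\gamma)$ (resp. $\mathrm c_2(\gamma)$) is the number of occurrences of $+_1$ (resp. $+_2$) in $\gamma$. *)

theory Defs
  imports
    "HOL-Library.Poly_Mapping"
    "HOL-Library.FuncSet"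
    "HOL-Computational_Algebra.Polynomial"
    "HOL-Computational_Algebra.Fraction_Field"
begin

section \<open>Formal power series in countably many commuting variables\<close>

text \<open>
  The variables are \<open>x\<^sub>i\<close> with \<open>i :: nat\<close>, a monomial is its finitely supported exponent
  map, and a series is its family of coefficients. No bounded-degree condition is imposed.
\<close>

typedef 'a mfps = "UNIV :: ((nat \<Rightarrow>\<^sub>0 nat) \<Rightarrow> 'a) set"
  morphisms mfps_nth Abs_mfps by simp

setup_lifting type_definition_mfps

lemma mfps_eqI: "(\<And>m. mfps_nth f m = mfps_nth g m) \<Longrightarrow> f = g"
  by transfer auto

definition splittings :: "(nat \<Rightarrow>\<^sub>0 nat) \<Rightarrow> ((nat \<Rightarrow>\<^sub>0 nat) \<times> (nat \<Rightarrow>\<^sub>0 nat)) set" where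
  "splittings m = {(a, b). a + b = m}"

lemma finite_splittings [simp, intro]: "finite (splittings m)"
proof -
  have fin1: "finite (fst ` splittings m)"
  proof (rule inj_on_finite)
    show "inj_on (\<lambda>a. restrict (Poly_Mapping.lookup a) (Poly_Mapping.keys m)) (fst ` splittings m)"
    proof (rule inj_onI, rule poly_mapping_eqI)
      fix a b :: "nat \<Rightarrow>\<^sub>0 nat" and k
      assume a: "a \<in> fst ` splittings m" and b: "b \<in> fst ` splittings m"
        and eq: "restrict (Poly_Mapping.lookup a) (Poly_Mapping.keys m) = restrict (Poly_Mapping.lookup b) (Poly_Mapping.keys m)"
      from a b obtain a' b' where "a + a' = m" "b + b' = m" by (auto simp: splittings_def)
      then have le: "Poly_Mapping.lookup a k \<le> Poly_Mapping.lookup m k" "Poly_Mapping.lookup b k \<le> Poly_Mapping.lookup m k"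
        by (metis le_add1 lookup_add)+
      show "Poly_Mapping.lookup a k = Poly_Mapping.lookup b k"
      proof (cases "k \<in> Poly_Mapping.keys m")
        case True
        then show ?thesis using fun_cong[OF eq, of k] by simp
      next
        case False
        then show ?thesis using le by (simp add: in_keys_iff)
      qed
    qed
    show "(\<lambda>a. restrict (Poly_Mapping.lookup a) (Poly_Mapping.keys m)) ` fst ` splittings m
        \<subseteq> (\<Pi>\<^sub>E k\<in> Poly_Mapping.keys m. {..Poly_Mapping.lookup m k})"
      by (auto simp: splittings_def lookup_add)
    show "finite (\<Pi>\<^sub>E k\<in> Poly_Mapping.keys m. {..Poly_Mapping.lookup m k})" by (intro finite_PiE) auto
  qed
  show ?thesis
  proof (rule inj_on_finite[OF _ subset_refl fin1])
    show "inj_on fst (splittings m)" by (auto simp: inj_on_def splittings_def)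
  qed
qed

instantiation mfps :: (comm_ring_1) comm_ring_1
begin

lift_definition zero_mfps :: "'a mfps" is "\<lambda>_. 0" .
lift_definition one_mfps :: "'a mfps" is "\<lambda>m. if m = 0 then 1 else 0" .
lift_definition plus_mfps :: "'a mfps \<Rightarrow> 'a mfps \<Rightarrow> 'a mfps" is "\<lambda>f g m. f m + g m" .
lift_definition minus_mfps :: "'a mfps \<Rightarrow> 'a mfps \<Rightarrow> 'a mfps" is "\<lambda>f g m. f m - g m" .
lift_definition uminus_mfps :: "'a mfps \<Rightarrow> 'a mfps" is "\<lambda>f m. - f m" .
lift_definition times_mfps :: "'a mfps \<Rightarrow> 'a mfps \<Rightarrow> 'a mfps" is
  "\<lambda>f g m. \<Sum>(a, b)\<in>splittings m. f a * g b" .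

instance
proof
  fix f g h :: "'a mfps"
  show "f * g * h = f * (g * h)"
  proof transfer
    fix f g h :: "(nat \<Rightarrow>\<^sub>0 nat) \<Rightarrow> 'a"
    show "(\<lambda>m. \<Sum>(x, c)\<in>splittings m. (\<Sum>(a, b)\<in>splittings x. f a * g b) * h c) =
          (\<lambda>m. \<Sum>(a, y)\<in>splittings m. f a * (\<Sum>(b, c)\<in>splittings y. g b * h c))"
    proof
      fix m
      have "(\<Sum>(x, c)\<in>splittings m. (\<Sum>(a, b)\<in>splittings x. f a * g b) * h c) =
        (\<Sum>((x, c), (a, b))\<in>Sigma (splittings m) (\<lambda>(x, c). splittings x). f a * g b * h c)"
        by (subst sum.Sigma[symmetric]) (auto simp: sum_distrib_right case_prod_unfold)
      also have "\<dots> =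
        (\<Sum>((a, y), (b, c))\<in>Sigma (splittings m) (\<lambda>(a, y). splittings y). f a * g b * h c)"
        by (rule sum.reindex_bij_witness
              [of _ "\<lambda>((a, y), (b, c)). ((a + b, c), (a, b))" "\<lambda>((x, c), (a, b)). ((a, b + c), (b, c))"])
           (auto simp: splittings_def add.assoc)
      also have "\<dots> = (\<Sum>(a, y)\<in>splittings m. f a * (\<Sum>(b, c)\<in>splittings y. g b * h c))"
        by (subst sum.Sigma[symmetric]) (auto simp: sum_distrib_left case_prod_unfold mult.assoc)
      finally show "(\<Sum>(x, c)\<in>splittings m. (\<Sum>(a, b)\<in>splittings x. f a * g b) * h c) =
        (\<Sum>(a, y)\<in>splittings m. f a * (\<Sum>(b, c)\<in>splittings y. g b * h c))" .
    qed
  qed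
  show "f * g = g * f"
  proof transfer
    fix f g :: "(nat \<Rightarrow>\<^sub>0 nat) \<Rightarrow> 'a"
    show "(\<lambda>m. \<Sum>(a, b)\<in>splittings m. f a * g b) = (\<lambda>m. \<Sum>(a, b)\<in>splittings m. g a * f b)"
      by (intro ext sum.reindex_bij_witness[of _ prod.swap prod.swap])
         (auto simp: splittings_def add.commute mult.commute)
  qed
  show "1 * f = f"
  proof transfer
    fix f :: "(nat \<Rightarrow>\<^sub>0 nat) \<Rightarrow> 'a"
    show "(\<lambda>m. \<Sum>(a, b)\<in>splittings m. (if a = 0 then 1 else 0) * f b) = f"
    proof
      fix m
      have "(\<Sum>(a, b)\<in>splittings m. (if a = 0 then 1 else 0) * f b) =
            (\<Sum>(a, b)\<in>{(0 :: nat \<Rightarrow>\<^sub>0 nat, m)}. (if a = 0 then 1 else 0) * f b)"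
        by (rule sum.mono_neutral_right[OF finite_splittings]) (auto simp: splittings_def split: if_splits)
      then show "(\<Sum>(a, b)\<in>splittings m. (if a = 0 then 1 else 0) * f b) = f m" by simp
    qed
  qed
  show "(f + g) * h = f * h + g * h"
    by transfer (simp add: distrib_right sum.distrib case_prod_unfold)
  show "(0 :: 'a mfps) \<noteq> 1" by transfer (auto simp: fun_eq_iff)
qed (transfer; simp add: fun_eq_iff algebra_simps)+

end

lift_definition mfps_scale :: "'a::comm_ring_1 \<Rightarrow> 'a mfps \<Rightarrow> 'a mfps" is "\<lambda>c f m. c * f m" .


section \<open>Compositions and enriched monomial quasisymmetric functions\<close>

definition is_composition :: "nat list \<Rightarrow> bool" where
  "is_composition \<alpha> \<longleftrightarrow> (\<forall>a\<in>set \<alpha>. 0 < a)"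

text \<open>\<open>coarsenings \<alpha>\<close> is \<open>{\<beta>. \<beta> \<succeq> \<alpha>}\<close>: cut \<open>\<alpha>\<close> into nonempty blocks and add up each block.\<close>

definition coarsenings :: "nat list \<Rightarrow> nat list set" where
  "coarsenings \<alpha> = {map sum_list bs |bs. concat bs = \<alpha> \<and> [] \<notin> set bs}"

lemma finite_coarsenings [simp, intro]: "finite (coarsenings \<alpha>)"
proof -
  have len: "length bs \<le> length (concat bs)" if "[] \<notin> set bs" for bs :: "nat list list"
    using that
  proof (induction bs)
    case (Cons b bs)
    then show ?case by (cases b) auto
  qed simp
  have part: "x \<le> sum_list (concat bs)" if "x \<in> set (map sum_list bs)" for x and bs :: "nat list list"
    using that by (induction bs) auto
  have "coarsenings \<alpha> \<subseteq> {xs. set xs \<subseteq> {..sum_list \<alpha>} \<and> length xs \<le> length \<alpha>}"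
    using len part by (fastforce simp: coarsenings_def)
  then show ?thesis
    by (rule finite_subset) (simp add: finite_lists_length_le)
qed

text \<open>
  The coefficient of a monomial in \<open>M\<^sub>\<alpha>\<close> is the number of index sequences
  \<open>i\<^sub>1 < \<dots> < i\<^sub>l\<close> that produce it.
\<close>

definition monomial_qsym :: "nat list \<Rightarrow> 'a::comm_ring_1 mfps" where
  "monomial_qsym \<alpha> = Abs_mfps (\<lambda>m. of_nat (card {is. length is = length \<alpha> \<and> sorted_wrt (<) is \<and>
     (\<Sum>k<length \<alpha>. Poly_Mapping.single (is ! k) (\<alpha> ! k)) = m}))"

definition eta :: "nat list \<Rightarrow> 'a::comm_ring_1 mfps" where
  "eta \<alpha> = (\<Sum>\<beta>\<in>coarsenings \<alpha>. mfps_scale (2 ^ length \<beta>) (monomial_qsym \<beta>))"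

text \<open>The indeterminate of the field of rational functions over the complex numbers.\<close>

definition qvar :: "complex poly fract" where
  "qvar = Fraction_Field.Fract [:0, 1:] 1"

definition eta_q :: "nat list \<Rightarrow> complex poly fract mfps" where
  "eta_q \<alpha> = (\<Sum>\<beta>\<in>coarsenings \<alpha>. mfps_scale ((qvar + 1) ^ length \<beta>) (monomial_qsym \<beta>))"


section \<open>Two-way overlapping shuffles\<close>

text \<open>
  Entries of \<open>\<alpha>\<close> are tagged \<open>Inl\<close> and entries of \<open>\<beta>\<close> are tagged \<open>Inr\<close>. The position set \<open>D\<close>
  of the entries of \<open>\<beta>\<close> is then recovered from a shuffle of the tagged words (this is
  \<open>bij_betw_tagged_shuffles\<close> below), so the set of tagged shuffles contains exactly one element
  for each choice of \<open>D\<close>, even where the untagged shuffles would coincide.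
\<close>

definition tagged_shuffles :: "nat list \<Rightarrow> nat list \<Rightarrow> (nat + nat) list set" where
  "tagged_shuffles \<alpha> \<beta> = shuffles (map Inl \<alpha>) (map Inr \<beta>)"

lemma bij_betw_tagged_shuffles:
  "bij_betw (\<lambda>w. {p. p < length w \<and> \<not> isl (w ! p)}) (tagged_shuffles \<alpha> \<beta>)
     {D. D \<subseteq> {..<length \<alpha> + length \<beta>} \<and> card D = length \<beta>}"
proof -
  let ?S = "tagged_shuffles \<alpha> \<beta>"
  let ?f = "\<lambda>w :: (nat + nat) list. {p. p < length w \<and> \<not> isl (w ! p)}"
  let ?T = "{D. D \<subseteq> {..<length \<alpha> + length \<beta>} \<and> card D = length \<beta>}"
  have disj: "set (map Inl \<alpha> :: (nat + nat) list) \<inter> set (map Inr \<beta>) = {}" by auto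
  have flt: "filter isl w = map Inl \<alpha>" "filter (\<lambda>x. \<not> isl x) w = map Inr \<beta>" if "w \<in> ?S" for w
  proof -
    have "filter isl w \<in> shuffles (filter isl (map Inl \<alpha>)) (filter isl (map Inr \<beta>))"
      using that unfolding tagged_shuffles_def by (metis filter_shuffles imageI)
    then show "filter isl w = map Inl \<alpha>" by (simp add: filter_map o_def)
    have "filter (\<lambda>x. \<not> isl x) w \<in>
        shuffles (filter (\<lambda>x. \<not> isl x) (map Inl \<alpha>)) (filter (\<lambda>x. \<not> isl x) (map Inr \<beta>))"
      using that unfolding tagged_shuffles_def by (metis filter_shuffles imageI)
    then show "filter (\<lambda>x. \<not> isl x) w = map Inr \<beta>" by (simp add: filter_map o_def)
  qed
  have len: "length w = length \<alpha> + length \<beta>" if "w \<in> ?S" for w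
    using that by (auto simp: tagged_shuffles_def dest: length_shuffles)
  have mask: "w = w'" if "map isl w = map isl w'" "filter isl w = filter isl w'"
    "filter (\<lambda>x. \<not> isl x) w = filter (\<lambda>x. \<not> isl x) w'" for w w' :: "(nat + nat) list"
    using that
  proof (induction w arbitrary: w')
    case (Cons x w)
    then obtain y v where "w' = y # v" by (cases w') auto
    with Cons show ?case by (auto split: if_splits)
  qed simp
  have inj: "inj_on ?f ?S"
  proof (rule inj_onI)
    fix w w' assume w: "w \<in> ?S" "w' \<in> ?S" and eq: "?f w = ?f w'"
    have "map isl w = map isl w'"
    proof (rule nth_equalityI)
      fix p assume "p < length (map isl w)"
      then show "map isl w ! p = map isl w' ! p"
        using eq len[OF w(1)] len[OF w(2)] by (auto simp: set_eq_iff)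
    qed (simp add: len w)
    then show "w = w'" by (rule mask) (simp_all only: flt w)
  qed
  have sub: "?f ` ?S \<subseteq> ?T"
  proof clarify
    fix w assume w: "w \<in> ?S"
    have "card (?f w) = length (filter (\<lambda>x. \<not> isl x) w)"
      by (simp add: length_filter_conv_card)
    then have "card (?f w) = length \<beta>" by (simp add: flt[OF w])
    with len[OF w] show "?f w \<subseteq> {..<length \<alpha> + length \<beta>} \<and> card (?f w) = length \<beta>" by auto
  qed
  have "card (?f ` ?S) = card ?S" using inj by (rule card_image)
  also have "\<dots> = (length \<alpha> + length \<beta>) choose length \<alpha>"
    unfolding tagged_shuffles_def by (subst card_disjoint_shuffles[OF disj]) simp
  also have "\<dots> = (length \<alpha> + length \<beta>) choose length \<beta>"
    using binomial_symmetric[of "length \<alpha>" "length \<alpha> + length \<beta>"] by simp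
  also have "\<dots> = card ?T" by (simp add: n_subsets)
  finally have "?f ` ?S = ?T" using sub by (intro card_subset_eq) auto
  with inj show ?thesis by (simp add: bij_betw_def)
qed

datatype sep = Comma | Plus1 | Plus2

text \<open>
  An expression is a tagged word together with its list of separators; the \<open>p\<close>-th separator
  stands between the \<open>p\<close>-th and the \<open>(p + 1)\<close>-st entry. As the words are tagged, the set below
  has one element for each choice of \<open>D\<close> and of the commas to be replaced, so that summing over
  it is summing over the multiset of two-way overlapping shuffles.
\<close>

type_synonym overlap_expr = "(nat + nat) list \<times> sep list"

definition two_way_overlapping_shuffles :: "nat list \<Rightarrow> nat list \<Rightarrow> overlap_expr set" where
  "two_way_overlapping_shuffles \<alpha> \<beta> = {(w, s). w \<in> tagged_shuffles \<alpha> \<beta> \<and> length s = length w - 1 \<and>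
     (\<forall>p<length s. (s ! p = Plus1 \<longrightarrow> isl (w ! p) \<and> \<not> isl (w ! Suc p)) \<and>
                   (s ! p = Plus2 \<longrightarrow> \<not> isl (w ! p) \<and> isl (w ! Suc p)))}"

lemma finite_two_way_overlapping_shuffles [simp, intro]:
  "finite (two_way_overlapping_shuffles \<alpha> \<beta>)"
proof -
  have UNIV_sep: "(UNIV :: sep set) = {Comma, Plus1, Plus2}"
    using sep.exhaust by auto
  have sub: "two_way_overlapping_shuffles \<alpha> \<beta> \<subseteq>
      tagged_shuffles \<alpha> \<beta> \<times> {s. set s \<subseteq> (UNIV :: sep set) \<and> length s = length \<alpha> + length \<beta> - 1}"
    by (auto simp: two_way_overlapping_shuffles_def tagged_shuffles_def dest: length_shuffles)
  have fin2: "finite {s. set s \<subseteq> (UNIV :: sep set) \<and> length s = length \<alpha> + length \<beta> - 1}"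
    by (rule finite_lists_length_eq) (simp add: UNIV_sep)
  have fin1: "finite (tagged_shuffles \<alpha> \<beta>)" by (simp add: tagged_shuffles_def)
  show ?thesis
    by (rule finite_subset[OF sub finite_cartesian_product[OF fin1 fin2]])
qed

fun add_up :: "nat list \<Rightarrow> sep list \<Rightarrow> nat list" where
  "add_up (a # b # w) (Comma # s) = a # add_up (b # w) s"
| "add_up (a # b # w) (_ # s) = add_up ((a + b) # w) s"
| "add_up w _ = w"

definition plus_comp :: "overlap_expr \<Rightarrow> nat list" where
  "plus_comp \<gamma> = add_up (map (case_sum id id) (fst \<gamma>)) (snd \<gamma>)"

definition c1 :: "overlap_expr \<Rightarrow> nat" where
  "c1 \<gamma> = count_list (snd \<gamma>) Plus1"

definition c2 :: "overlap_expr \<Rightarrow> nat" where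
  "c2 \<gamma> = count_list (snd \<gamma>) Plus2"

end

theory Submission
  imports Defs
begin

text \<open>
  Both identities are instances, \<open>q = 1\<close> and \<open>q = qvar\<close>, of one identity for the series
  \<open>enriched q\<close> over an arbitrary commutative ring. The idea is to reduce it to a single
  variable.

  The monomials of the enriched function of \<open>\<alpha>\<close> arise from weakly increasing assignments of
  variables to the parts of \<open>\<alpha>\<close>. Splitting the variables into \<open>x\<^sub>0, \<dots>, x\<^sub>n\<^sub>-\<^sub>1\<close> and \<open>x\<^sub>n\<close> cuts \<open>\<alpha>\<close>
  into an initial and a final part, so that the enriched function in \<open>n + 1\<close> variables is the
  convolution, with respect to deconcatenation of \<open>\<alpha>\<close>, of the enriched function in \<open>n\<close>
  variables with the enriched function in one variable (\<open>trunc_enriched_Suc\<close>). On the other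
  side, cutting an overlapping shuffle at one of its commas cuts \<open>\<alpha>\<close> and \<open>\<beta>\<close> as well, and
  leaves an overlapping shuffle of the two initial parts and one of the two final parts; signs
  and powers of \<open>q\<close> multiply. In other words, the product of words on the right-hand side is
  compatible with deconcatenation, and therefore the functionals that are multiplicative for it,
  its characters, are closed under convolution (\<open>is_character_deconc_conv\<close>).

  What remains is one variable \<open>x\<close> (\<open>is_character_one_var\<close>), where the enriched function of a
  nonempty \<open>\<alpha>\<close> is \<open>(q + 1) x\<^sup>|\<^sup>\<alpha>\<^sup>|\<close>. This depends on the total degree alone, so for a fixed
  shuffle the choices at the commas are independent. A pair \<open>(\<alpha>\<^sub>i, \<beta>\<^sub>j)\<close> contributes the factor
  \<open>1 + q\<close>, and a pair \<open>(\<beta>\<^sub>j, \<alpha>\<^sub>i)\<close> contributes \<open>1 - 1 = 0\<close>. Hence, for nonempty \<open>\<alpha>\<close> and \<open>\<beta>\<close>, only the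
  shuffle \<open>\<alpha>\<^sub>1 \<dots> \<alpha>\<^sub>l \<beta>\<^sub>1 \<dots> \<beta>\<^sub>k\<close> survives, with total weight \<open>1 + q\<close>, and this is the second factor
  of \<open>(q + 1)\<^sup>2\<close> on the left-hand side.

  Since the coefficient of a monomial involves finitely many variables only, the identity for all
  truncations gives the identity of power series.
\<close>

section \<open>Deconcatenation and merging of letters\<close>

definition deconc_conv :: "('b list \<Rightarrow> 'r) \<Rightarrow> ('b list \<Rightarrow> 'r) \<Rightarrow> 'b list \<Rightarrow> 'r::comm_ring_1" where
  "deconc_conv A B l = (\<Sum>k\<le>length l. A (take k l) * B (drop k l))"

lemma deconc_conv_Nil [simp]: "deconc_conv A B [] = A [] * B []"
  by (simp add: deconc_conv_def)

lemma deconc_conv_Cons: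
  "deconc_conv A B (x # l) = A [] * B (x # l) + deconc_conv (\<lambda>l. A (x # l)) B l"
  unfolding deconc_conv_def by (simp add: sum.atMost_Suc_shift del: sum.atMost_Suc)

abbreviation val :: "nat + nat \<Rightarrow> nat" where
  "val \<equiv> case_sum id id"

text \<open>
  A merged block behaves towards its right neighbour like its last letter, so it inherits the tag
  of the latter.
\<close>

definition merge :: "nat + nat \<Rightarrow> nat + nat \<Rightarrow> nat + nat" where
  "merge x y = map_sum ((+) (val x)) ((+) (val x)) y"

lemma isl_merge [simp]: "isl (merge x y) = isl y"
  by (cases y) (simp_all add: merge_def)

lemma val_merge [simp]: "val (merge x y) = val x + val y"
  by (cases y) (simp_all add: merge_def)

lemma merge_Inl [simp]: "merge (Inl a) (Inl b) = Inl (a + b)"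
  by (simp add: merge_def)

text \<open>
  Each comma of \<open>w\<close> is either kept or turned into a plus, the latter at the price of a factor
  \<open>c\<close> that depends on the tags of its two neighbours; \<open>\<Phi>\<close> is summed over the results. With
  \<open>c = 1\<close> this is a sum over coarsenings, and with \<open>overlap_weight q\<close> it is a sum over the
  overlapping shuffles with a given underlying shuffle. Reading \<open>w\<close> from the left, a kept comma
  releases the first letter for good, and a plus replaces the first two letters by one.
\<close>

fun merge_sum ::
  "(bool \<Rightarrow> bool \<Rightarrow> 'r::comm_ring_1) \<Rightarrow> (nat list \<Rightarrow> 'r) \<Rightarrow> (nat + nat) list \<Rightarrow> 'r" where
  "merge_sum c \<Phi> [] = \<Phi> []"
| "merge_sum c \<Phi> [x] = \<Phi> [val x]"
| "merge_sum c \<Phi> (x # y # w) =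
     merge_sum c (\<lambda>l. \<Phi> (val x # l)) (y # w) + c (isl x) (isl y) * merge_sum c \<Phi> (merge x y # w)"

lemma merge_sum_add:
  "merge_sum c (\<lambda>l. \<Phi> l + \<Psi> l) w = merge_sum c \<Phi> w + merge_sum c \<Psi> w"
proof (induction w arbitrary: \<Phi> \<Psi> rule: length_induct)
  case (1 w)
  then show ?case
    by (cases w rule: remdups_adj.cases) (simp_all add: algebra_simps)
qed

lemma merge_sum_cmult: "merge_sum c (\<lambda>l. a * \<Phi> l) w = a * merge_sum c \<Phi> w"
proof (induction w arbitrary: \<Phi> rule: length_induct)
  case (1 w)
  then show ?case
    by (cases w rule: remdups_adj.cases) (simp_all add: algebra_simps)
qed

text \<open>
  Merging letters never empties a nonempty word, so the value of \<open>\<Phi>\<close> at the empty list is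
  irrelevant.
\<close>

lemma merge_sum_cong_nonempty:
  assumes "\<And>l. l \<noteq> [] \<Longrightarrow> \<Phi> l = \<Psi> l" and "w \<noteq> []"
  shows "merge_sum c \<Phi> w = merge_sum c \<Psi> w"
  using assms
proof (induction w arbitrary: \<Phi> \<Psi> rule: length_induct)
  case (1 w)
  show ?case
  proof (cases w rule: remdups_adj.cases)
    case (3 x y v)
    have "merge_sum c (\<lambda>l. \<Phi> (val x # l)) (y # v) = merge_sum c (\<lambda>l. \<Psi> (val x # l)) (y # v)"
      using 1 3 by simp
    moreover have "merge_sum c \<Phi> (merge x y # v) = merge_sum c \<Psi> (merge x y # v)"
      using 1 3 by simp
    ultimately show ?thesis using 3 by simp
  qed (use 1 in simp_all)
qed

lemma merge_sum_zero [simp]: "merge_sum c (\<lambda>_. 0) w = 0"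
  using merge_sum_cmult[of c 0 "\<lambda>_. 0" w] by simp

text \<open>
  A cut of a merged word takes place at a comma that has been kept. It therefore comes from a cut
  of \<open>w\<close> itself, and the choices on the two sides are independent.
\<close>

lemma merge_sum_deconc_conv:
  "merge_sum c (deconc_conv A B) = deconc_conv (merge_sum c A) (merge_sum c B)"
proof
  fix w
  show "merge_sum c (deconc_conv A B) w = deconc_conv (merge_sum c A) (merge_sum c B) w"
  proof (induction w arbitrary: A rule: length_induct)
    case (1 w)
    show ?case
    proof (cases w rule: remdups_adj.cases)
      case (3 x y v)
      let ?Ax = "\<lambda>l. A (val x # l)"
      have IH1: "merge_sum c (deconc_conv ?Ax B) (y # v) =
          deconc_conv (merge_sum c ?Ax) (merge_sum c B) (y # v)"
        using 1 3 by simp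
      have IH2: "merge_sum c (deconc_conv A B) (merge x y # v) =
          deconc_conv (merge_sum c A) (merge_sum c B) (merge x y # v)"
        using 1 3 by simp
      have step: "merge_sum c (deconc_conv A B) (x # y # v) =
          A [] * merge_sum c (\<lambda>l. B (val x # l)) (y # v)
          + deconc_conv (merge_sum c ?Ax) (merge_sum c B) (y # v)
          + c (isl x) (isl y) * deconc_conv (merge_sum c A) (merge_sum c B) (merge x y # v)"
        by (simp add: deconc_conv_Cons merge_sum_add merge_sum_cmult IH1 IH2)
      \<comment> \<open>The cuts behind the second letter; the cuts before and behind the first one are split off.\<close>
      have tails: "deconc_conv (\<lambda>l. merge_sum c A (x # y # l)) (merge_sum c B) v =
          deconc_conv (\<lambda>l. merge_sum c ?Ax (y # l)) (merge_sum c B) v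
          + c (isl x) (isl y) * deconc_conv (\<lambda>l. merge_sum c A (merge x y # l)) (merge_sum c B) v"
        by (simp add: deconc_conv_def sum.distrib sum_distrib_left algebra_simps)
      show ?thesis
        unfolding 3 step deconc_conv_Cons tails by (simp add: algebra_simps)
    qed (simp_all add: deconc_conv_def)
  qed
qed


section \<open>Sums over shuffles\<close>

lemma sum_shuffles_Cons:
  fixes F :: "'b list \<Rightarrow> 'r::comm_monoid_add"
  assumes "x \<noteq> y"
  shows "(\<Sum>w\<in>shuffles (x # xs) (y # ys). F w) =
    (\<Sum>w\<in>shuffles xs (y # ys). F (x # w)) + (\<Sum>w\<in>shuffles (x # xs) ys. F (y # w))"
proof -
  have "(\<Sum>w\<in>shuffles (x # xs) (y # ys). F w) =
      (\<Sum>w\<in>(#) x ` shuffles xs (y # ys). F w) + (\<Sum>w\<in>(#) y ` shuffles (x # xs) ys. F w)"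
    using assms by (simp only: shuffles.simps) (subst sum.union_disjoint; auto)
  then show ?thesis by (simp add: sum.reindex inj_on_def)
qed

text \<open>
  The three sources of a cut shuffle in the lemma below: the part in front of the cut is empty, or
  begins with the first letter of one of the two words.
\<close>

lemma sum_grid_Suc:
  fixes G :: "nat \<Rightarrow> nat \<Rightarrow> 'r::comm_monoid_add"
  assumes "\<And>i. G (Suc i) 0 = X i 0" and "\<And>j. G 0 (Suc j) = Y 0 j"
    and "\<And>i j. G (Suc i) (Suc j) = X i (Suc j) + Y (Suc i) j"
  shows "(\<Sum>i\<le>Suc a. \<Sum>j\<le>Suc b. G i j) =
    G 0 0 + (\<Sum>i\<le>a. \<Sum>j\<le>Suc b. X i j) + (\<Sum>i\<le>Suc a. \<Sum>j\<le>b. Y i j)"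
  by (simp add: sum.atMost_Suc_shift assms sum.distrib ac_simps del: sum.atMost_Suc)

text \<open>
  A cut of a shuffle of \<open>xs\<close> and \<open>ys\<close> amounts to a cut of each of the two words, a shuffle of the
  initial parts and a shuffle of the final parts. Disjointness of the letters ensures that the set
  of shuffles does not identify two different ways of shuffling.
\<close>

lemma sum_shuffles_deconc_conv:
  fixes f g :: "'b list \<Rightarrow> 'r::comm_ring_1"
  assumes "set xs \<inter> set ys = {}"
  shows "(\<Sum>w\<in>shuffles xs ys. deconc_conv f g w) =
    (\<Sum>i\<le>length xs. \<Sum>j\<le>length ys.
       (\<Sum>u\<in>shuffles (take i xs) (take j ys). f u) * (\<Sum>v\<in>shuffles (drop i xs) (drop j ys). g v))"
  using assms
proof (induction xs ys arbitrary: f rule: shuffles.induct)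
  case (1 ys)
  then show ?case by (simp add: deconc_conv_def)
next
  case (2 xs)
  then show ?case by (simp add: deconc_conv_def)
next
  case (3 x xs y ys)
  have xy: "x \<noteq> y" using "3.prems" by auto
  let ?V = "\<lambda>i j. \<Sum>v\<in>shuffles (drop i (x # xs)) (drop j (y # ys)). g v"
  let ?X = "\<lambda>i j. (\<Sum>u\<in>shuffles (take i xs) (take j (y # ys)). f (x # u)) * ?V (Suc i) j"
  let ?Y = "\<lambda>i j. (\<Sum>u\<in>shuffles (take i (x # xs)) (take j ys). f (y # u)) * ?V i (Suc j)"
  let ?G = "\<lambda>i j. (\<Sum>u\<in>shuffles (take i (x # xs)) (take j (y # ys)). f u) * ?V i j"
  have "(\<Sum>w\<in>shuffles (x # xs) (y # ys). deconc_conv f g w) =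
      f [] * ?V 0 0
      + (\<Sum>w\<in>shuffles xs (y # ys). deconc_conv (\<lambda>l. f (x # l)) g w)
      + (\<Sum>w\<in>shuffles (x # xs) ys. deconc_conv (\<lambda>l. f (y # l)) g w)"
    using xy by (simp add: sum_shuffles_Cons deconc_conv_Cons sum.distrib sum_distrib_left
        distrib_left ac_simps del: shuffles.simps)
  also have "(\<Sum>w\<in>shuffles xs (y # ys). deconc_conv (\<lambda>l. f (x # l)) g w) =
      (\<Sum>i\<le>length xs. \<Sum>j\<le>Suc (length ys). ?X i j)"
    using 3 by simp
  also have "(\<Sum>w\<in>shuffles (x # xs) ys. deconc_conv (\<lambda>l. f (y # l)) g w) =
      (\<Sum>i\<le>Suc (length xs). \<Sum>j\<le>length ys. ?Y i j)"
    using 3 by simp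
  also have "f [] * ?V 0 0 = ?G 0 0" by simp
  also have "?G 0 0 + (\<Sum>i\<le>length xs. \<Sum>j\<le>Suc (length ys). ?X i j)
      + (\<Sum>i\<le>Suc (length xs). \<Sum>j\<le>length ys. ?Y i j) =
      (\<Sum>i\<le>Suc (length xs). \<Sum>j\<le>Suc (length ys). ?G i j)"
    by (rule sum_grid_Suc[symmetric])
      (simp_all add: xy sum_shuffles_Cons distrib_right del: shuffles.simps(3))
  finally show ?case by simp
qed


section \<open>Characters of the overlapping shuffle product\<close>

fun overlap_weight :: "'r::comm_ring_1 \<Rightarrow> bool \<Rightarrow> bool \<Rightarrow> 'r" where
  "overlap_weight q True False = q"
| "overlap_weight q False True = - 1"
| "overlap_weight q _ _ = 0"

text \<open>
  The value of the linear functional \<open>\<Phi>\<close> at the product of \<open>\<alpha>\<close> and \<open>\<beta>\<close>, where the product is the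
  bilinear operation on words that is given by the signed and weighted sum of all two-way
  overlapping shuffles (\<open>sum_two_way_overlapping_shuffles\<close> below).
\<close>

definition overlap_prod :: "'r::comm_ring_1 \<Rightarrow> (nat list \<Rightarrow> 'r) \<Rightarrow> nat list \<Rightarrow> nat list \<Rightarrow> 'r" where
  "overlap_prod q \<Phi> \<alpha> \<beta> = (\<Sum>w\<in>tagged_shuffles \<alpha> \<beta>. merge_sum (overlap_weight q) \<Phi> w)"

definition is_character :: "'r::comm_ring_1 \<Rightarrow> (nat list \<Rightarrow> 'r) \<Rightarrow> bool" where
  "is_character q \<Phi> \<longleftrightarrow> (\<forall>\<alpha> \<beta>. overlap_prod q \<Phi> \<alpha> \<beta> = \<Phi> \<alpha> * \<Phi> \<beta>)"

text \<open>
  The overlapping shuffle product is compatible with deconcatenation as in a bialgebra, and the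
  convolution of two characters of a bialgebra with values in a commutative ring is a character.
  The compatibility is the combination of \<open>merge_sum_deconc_conv\<close>, for a fixed shuffle, with
  \<open>sum_shuffles_deconc_conv\<close>.
\<close>

lemma is_character_deconc_conv:
  assumes "is_character q A" and "is_character q B"
  shows "is_character q (deconc_conv A B)"
  unfolding is_character_def
proof (intro allI)
  fix \<alpha> \<beta> :: "nat list"
  let ?T = "merge_sum (overlap_weight q)"
  have "overlap_prod q (deconc_conv A B) \<alpha> \<beta> =
      (\<Sum>w\<in>shuffles (map Inl \<alpha>) (map Inr \<beta>). deconc_conv (?T A) (?T B) w)"
    by (simp add: overlap_prod_def tagged_shuffles_def merge_sum_deconc_conv)
  also have "\<dots> = (\<Sum>i\<le>length \<alpha>. \<Sum>j\<le>length \<beta>.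
      overlap_prod q A (take i \<alpha>) (take j \<beta>) * overlap_prod q B (drop i \<alpha>) (drop j \<beta>))"
    by (subst sum_shuffles_deconc_conv)
      (auto simp: overlap_prod_def tagged_shuffles_def take_map drop_map)
  also have "\<dots> = (\<Sum>i\<le>length \<alpha>. \<Sum>j\<le>length \<beta>.
      (A (take i \<alpha>) * B (drop i \<alpha>)) * (A (take j \<beta>) * B (drop j \<beta>)))"
    using assms by (simp add: is_character_def ac_simps)
  also have "\<dots> = deconc_conv A B \<alpha> * deconc_conv A B \<beta>"
    by (simp add: deconc_conv_def sum_product)
  finally show "overlap_prod q (deconc_conv A B) \<alpha> \<beta> = deconc_conv A B \<alpha> * deconc_conv A B \<beta>" .
qed

lemma merge_sum_counit:
  "merge_sum c (\<lambda>l. if l = [] then 1 else 0) w = (if w = [] then 1 else 0)"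
proof (cases "w = []")
  case False
  then have "merge_sum c (\<lambda>l. if l = [] then 1 else 0) w = merge_sum c (\<lambda>_. 0) w"
    by (intro merge_sum_cong_nonempty) auto
  with False show ?thesis by simp
qed simp

text \<open>
  This is the enriched function in no variables, the start of the induction on their number.
\<close>

lemma is_character_counit: "is_character q (\<lambda>l. if l = [] then 1 else 0)"
proof -
  have "(\<Sum>w\<in>tagged_shuffles \<alpha> \<beta>. if w = [] then 1 else 0 :: 'a) =
      (if \<alpha> = [] then 1 else 0) * (if \<beta> = [] then 1 else 0)" for \<alpha> \<beta>
    by (auto simp: sum.delta tagged_shuffles_def)
  then show ?thesis
    by (simp add: is_character_def overlap_prod_def merge_sum_counit)
qed

text \<open>
  The total weight of all choices at the commas of a word, which factors over its adjacent pairs.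
\<close>

fun run_weight :: "(bool \<Rightarrow> bool \<Rightarrow> 'r::comm_ring_1) \<Rightarrow> (nat + nat) list \<Rightarrow> 'r" where
  "run_weight c (x # y # w) = (1 + c (isl x) (isl y)) * run_weight c (y # w)"
| "run_weight c _ = 1"

lemma run_weight_merge: "run_weight c (merge x y # w) = run_weight c (y # w)"
  by (cases w) simp_all

text \<open>
  Merging letters preserves the total degree, so a functional of the total degree does not see
  which commas have been replaced.
\<close>

lemma merge_sum_total_degree:
  "merge_sum c (\<lambda>l. f (sum_list l)) w = f (sum_list (map val w)) * run_weight c w"
proof (induction w arbitrary: f rule: length_induct)
  case (1 w)
  show ?case
  proof (cases w rule: remdups_adj.cases)
    case (3 x y v)
    have "merge_sum c (\<lambda>l. f (val x + sum_list l)) (y # v) =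
        f (val x + sum_list (map val (y # v))) * run_weight c (y # v)"
      using 1[rule_format, of "y # v" "\<lambda>s. f (val x + s)"] 3 by simp
    moreover have "merge_sum c (\<lambda>l. f (sum_list l)) (merge x y # v) =
        f (sum_list (map val (merge x y # v))) * run_weight c (merge x y # v)"
      using 1[rule_format, of "merge x y # v" f] 3 by simp
    ultimately show ?thesis
      using 3 by (simp add: run_weight_merge algebra_simps)
  qed simp_all
qed

lemma run_weight_map_Inl: "run_weight (overlap_weight q) (map Inl \<alpha>) = 1"
  by (induction \<alpha> rule: induct_list012) simp_all

lemma run_weight_map_Inr: "run_weight (overlap_weight q) (map Inr \<beta>) = 1"
  by (induction \<beta> rule: induct_list012) simp_all

text \<open>
  After a letter of the second word, some later letter of the first word is immediately preceded by one
  of the second. This pair has the factor \<open>1 - 1\<close>.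
\<close>

lemma sum_run_weight_Inr:
  "(\<Sum>w\<in>shuffles (map Inl (a # \<alpha>)) (map Inr \<beta>). run_weight (overlap_weight q) (Inr b # w)) = 0"
  by (induction \<beta> arbitrary: b) (simp_all add: sum_shuffles_Cons del: shuffles.simps(3))

text \<open>
  After a letter of the first word, the only surviving shuffle exhausts the first word and then
  runs through the second. It has a single change of tags, and this has the factor \<open>1 + q\<close>.
\<close>

lemma sum_run_weight_Inl:
  "(\<Sum>w\<in>shuffles (map Inl \<alpha>) (map Inr (b # \<beta>)). run_weight (overlap_weight q) (Inl a # w)) = 1 + q"
proof (induction \<alpha> arbitrary: a)
  case Nil
  show ?case using run_weight_map_Inr[of q "b # \<beta>"] by simp
next
  case (Cons a' \<alpha>)
  have "(\<Sum>w\<in>shuffles (map Inl (a' # \<alpha>)) (map Inr \<beta>).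
      (1 + q) * run_weight (overlap_weight q) (Inr b # w)) = 0"
    by (simp only: sum_distrib_left[symmetric] sum_run_weight_Inr mult_zero_right)
  then show ?case
    using Cons by (simp add: sum_shuffles_Cons del: shuffles.simps)
qed

lemma sum_run_weight:
  assumes "\<alpha> \<noteq> []" and "\<beta> \<noteq> []"
  shows "(\<Sum>w\<in>tagged_shuffles \<alpha> \<beta>. run_weight (overlap_weight q) w) = 1 + q"
proof -
  obtain a \<alpha>' b \<beta>' where ab: "\<alpha> = a # \<alpha>'" "\<beta> = b # \<beta>'"
    using assms by (auto simp: neq_Nil_conv)
  show ?thesis
    using sum_run_weight_Inl[where a = a and b = b and \<alpha> = \<alpha>' and \<beta> = \<beta>' and q = q]
      sum_run_weight_Inr[where a = a and b = b and \<alpha> = \<alpha>' and \<beta> = \<beta>' and q = q]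
    by (simp add: ab tagged_shuffles_def sum_shuffles_Cons del: shuffles.simps)
qed

text \<open>
  For \<open>X d = x\<^sup>d\<close> and \<open>r = q + 1\<close> this is the enriched function in the single variable \<open>x\<close>: a
  monomial quasisymmetric function of length at least two vanishes in one variable, so that only
  the coarsening of \<open>l\<close> to one part contributes.
\<close>

definition one_var :: "'r::comm_ring_1 \<Rightarrow> (nat \<Rightarrow> 'r) \<Rightarrow> nat list \<Rightarrow> 'r" where
  "one_var r X l = (if l = [] then 1 else r * X (sum_list l))"

lemma merge_sum_one_var:
  assumes "w \<noteq> []"
  shows "merge_sum c (one_var r X) w = r * X (sum_list (map val w)) * run_weight c w"
proof -
  have "merge_sum c (one_var r X) w = merge_sum c (\<lambda>l. r * X (sum_list l)) w"
    using assms by (intro merge_sum_cong_nonempty) (simp_all add: one_var_def)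
  then show ?thesis
    using merge_sum_total_degree[of c "\<lambda>s. r * X s" w] by simp
qed

lemma sum_list_tagged_shuffle:
  assumes "w \<in> tagged_shuffles \<alpha> \<beta>"
  shows "sum_list (map val w) = sum_list \<alpha> + sum_list \<beta>"
proof -
  have "sum_list (map val w) = sum_list (map val (map Inl \<alpha>)) + sum_list (map val (map Inr \<beta>))"
    using assms unfolding tagged_shuffles_def
    by (induction "map Inl \<alpha> :: (nat + nat) list" "map Inr \<beta> :: (nat + nat) list"
          arbitrary: w \<alpha> \<beta> rule: shuffles.induct) (fastforce simp: Cons_eq_map_conv)+
  then show ?thesis by (simp add: o_def)
qed

text \<open>
  The product of the values at two nonempty compositions has the factor \<open>(q + 1)\<^sup>2\<close>. One factor
  \<open>q + 1\<close> belongs to the single part that remains after merging, the other one is the sum of the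
  weights of all shuffles.
\<close>

lemma is_character_one_var:
  assumes X: "\<And>a b. X (a + b) = X a * X b"
  shows "is_character q (one_var (q + 1) X)"
  unfolding is_character_def
proof (intro allI)
  fix \<alpha> \<beta> :: "nat list"
  let ?h = "one_var (q + 1) X"
  consider "\<alpha> = []" | "\<beta> = []" | "\<alpha> \<noteq> []" "\<beta> \<noteq> []" by blast
  then show "overlap_prod q ?h \<alpha> \<beta> = ?h \<alpha> * ?h \<beta>"
  proof cases
    case 1
    then show ?thesis
      by (cases "\<beta> = []") (simp_all add: overlap_prod_def tagged_shuffles_def merge_sum_one_var
          run_weight_map_Inr o_def, simp_all add: one_var_def)
  next
    case 2
    then show ?thesis
      by (cases "\<alpha> = []") (simp_all add: overlap_prod_def tagged_shuffles_def merge_sum_one_var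
          run_weight_map_Inl o_def, simp_all add: one_var_def)
  next
    case 3
    have "w \<noteq> []" if "w \<in> tagged_shuffles \<alpha> \<beta>" for w
      using that 3 by (auto simp: tagged_shuffles_def)
    then have "overlap_prod q ?h \<alpha> \<beta> = (\<Sum>w\<in>tagged_shuffles \<alpha> \<beta>.
        (q + 1) * X (sum_list \<alpha> + sum_list \<beta>) * run_weight (overlap_weight q) w)"
      by (simp add: overlap_prod_def merge_sum_one_var sum_list_tagged_shuffle)
    also have "\<dots> = (q + 1) * X (sum_list \<alpha> + sum_list \<beta>) * (1 + q)"
      by (simp only: sum_distrib_left[symmetric] sum_run_weight[OF 3])
    finally show ?thesis
      using 3 by (simp add: one_var_def X ac_simps)
  qed
qed


section \<open>Merging letters by separators and by coarsening\<close>

definition separators :: "(nat + nat) list \<Rightarrow> sep list set" where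
  "separators w = {s. length s = length w - 1 \<and>
     (\<forall>p<length s. (s ! p = Plus1 \<longrightarrow> isl (w ! p) \<and> \<not> isl (w ! Suc p)) \<and>
                   (s ! p = Plus2 \<longrightarrow> \<not> isl (w ! p) \<and> isl (w ! Suc p)))}"

lemma two_way_overlapping_shuffles_Sigma:
  "two_way_overlapping_shuffles \<alpha> \<beta> = Sigma (tagged_shuffles \<alpha> \<beta>) separators"
  by (auto simp: two_way_overlapping_shuffles_def separators_def)

fun allowed :: "sep \<Rightarrow> bool \<Rightarrow> bool \<Rightarrow> bool" where
  "allowed Comma _ _ = True"
| "allowed Plus1 i j = (i \<and> \<not> j)"
| "allowed Plus2 i j = (\<not> i \<and> j)"

lemma separators_short: "length w \<le> 1 \<Longrightarrow> separators w = {[]}"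
  by (auto simp: separators_def)

text \<open>
  The condition on separators is local, which makes sums over them recursive in the same way as
  \<open>merge_sum\<close>.
\<close>

lemma separators_Cons2:
  "separators (x # y # w) =
    {a # s |a s. allowed a (isl x) (isl y) \<and> s \<in> separators (y # w)}"
proof (intro equalityI subsetI)
  fix t assume t: "t \<in> separators (x # y # w)"
  then obtain a s where "t = a # s" by (cases t) (auto simp: separators_def)
  with t show "t \<in> {a # s |a s. allowed a (isl x) (isl y) \<and> s \<in> separators (y # w)}"
    by (cases a) (auto simp: separators_def All_less_Suc2)
next
  fix t assume "t \<in> {a # s |a s. allowed a (isl x) (isl y) \<and> s \<in> separators (y # w)}"
  then obtain a s where "t = a # s" "allowed a (isl x) (isl y)" "s \<in> separators (y # w)" by auto
  then show "t \<in> separators (x # y # w)"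
    by (cases a) (auto simp: separators_def All_less_Suc2)
qed

lemma finite_separators: "finite (separators w)"
proof -
  have "(UNIV :: sep set) = {Comma, Plus1, Plus2}" using sep.exhaust by auto
  then have "finite (UNIV :: sep set)" by (metis finite.emptyI finite_insert)
  then have "finite {s. set s \<subseteq> (UNIV :: sep set) \<and> length s = length w - 1}"
    by (rule finite_lists_length_eq)
  then show ?thesis by (rule rev_finite_subset) (auto simp: separators_def)
qed

lemma separators_merge: "separators (merge x y # w) = separators (y # w)"
proof -
  have "isl ((merge x y # w) ! p) = isl ((y # w) ! p)" for p by (cases p) simp_all
  then show ?thesis by (simp add: separators_def)
qed

definition sep_weight :: "'r::comm_ring_1 \<Rightarrow> sep list \<Rightarrow> 'r" where
  "sep_weight q s = (- 1) ^ count_list s Plus2 * q ^ count_list s Plus1"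

text \<open>
  At most one of the two plus signs is allowed between two given letters, so every separator is a
  choice between a comma and this plus sign. Its weight is \<open>overlap_weight q\<close>, which is zero where
  neither plus sign is allowed.
\<close>

lemma sum_separators:
  "(\<Sum>s\<in>separators w. sep_weight q s * \<Phi> (add_up (map val w) s)) =
    merge_sum (overlap_weight q) \<Phi> w"
proof (induction w arbitrary: \<Phi> rule: length_induct)
  case (1 w)
  show ?case
  proof (cases w rule: remdups_adj.cases)
    case (3 x y v)
    let ?S = "separators (y # v)"
    let ?F = "\<lambda>t. sep_weight q t * \<Phi> (add_up (map val (x # y # v)) t)"
    have IH1: "(\<Sum>s\<in>?S. sep_weight q s * \<Phi> (val x # add_up (map val (y # v)) s)) =
        merge_sum (overlap_weight q) (\<lambda>l. \<Phi> (val x # l)) (y # v)"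
      using 1[rule_format, of "y # v" "\<lambda>l. \<Phi> (val x # l)"] 3 by simp
    have IH2: "(\<Sum>s\<in>?S. sep_weight q s * \<Phi> (add_up ((val x + val y) # map val v) s)) =
        merge_sum (overlap_weight q) \<Phi> (merge x y # v)"
      using 1[rule_format, of "merge x y # v" \<Phi>] 3 by (simp add: separators_merge)
    have img: "(\<Sum>t\<in>(#) a ` ?S. ?F t) = (\<Sum>s\<in>?S. ?F (a # s))" for a
      by (simp add: sum.reindex inj_on_def)
    have comma: "(\<Sum>s\<in>?S. ?F (Comma # s)) =
        merge_sum (overlap_weight q) (\<lambda>l. \<Phi> (val x # l)) (y # v)"
      by (simp add: IH1[symmetric] sep_weight_def)
    have plus1: "(\<Sum>s\<in>?S. ?F (Plus1 # s)) = q * merge_sum (overlap_weight q) \<Phi> (merge x y # v)"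
      by (simp add: IH2[symmetric] sep_weight_def sum_distrib_left ac_simps)
    have plus2: "(\<Sum>s\<in>?S. ?F (Plus2 # s)) = - merge_sum (overlap_weight q) \<Phi> (merge x y # v)"
      by (simp add: IH2[symmetric] sep_weight_def sum_negf ac_simps)
    have union: "(\<Sum>t\<in>(#) Comma ` ?S \<union> (#) a ` ?S. ?F t) =
        (\<Sum>s\<in>?S. ?F (Comma # s)) + (\<Sum>s\<in>?S. ?F (a # s))" if "a \<noteq> Comma" for a
      unfolding img[symmetric] using that by (intro sum.union_disjoint) (auto simp: finite_separators)
    have "(\<Sum>t\<in>separators (x # y # v). ?F t) =
        merge_sum (overlap_weight q) \<Phi> (x # y # v)"
    proof (cases "isl x"; cases "isl y")
      assume xy: "isl x" "\<not> isl y"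
      have "separators (x # y # v) = (#) Comma ` ?S \<union> (#) Plus1 ` ?S"
        using xy by (auto simp: separators_Cons2 elim: allowed.elims)
      then show ?thesis
        using xy by (simp only: union[OF sep.distinct(2)] comma plus1) simp
    next
      assume xy: "\<not> isl x" "isl y"
      have "separators (x # y # v) = (#) Comma ` ?S \<union> (#) Plus2 ` ?S"
        using xy by (auto simp: separators_Cons2 elim: allowed.elims)
      then show ?thesis
        using xy by (simp only: union[OF sep.distinct(4)] comma plus2) simp
    next
      assume xy: "isl x" "isl y"
      have "separators (x # y # v) = (#) Comma ` ?S"
        using xy by (auto simp: separators_Cons2 elim: allowed.elims)
      then show ?thesis using xy by (simp only: img comma) simp
    next
      assume xy: "\<not> isl x" "\<not> isl y"
      have "separators (x # y # v) = (#) Comma ` ?S"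
        using xy by (auto simp: separators_Cons2 elim: allowed.elims)
      then show ?thesis using xy by (simp only: img comma) simp
    qed
    then show ?thesis using 3 by simp
  qed (simp_all add: separators_short sep_weight_def)
qed

lemma sum_two_way_overlapping_shuffles:
  "(\<Sum>\<gamma>\<in>two_way_overlapping_shuffles \<alpha> \<beta>. (- 1) ^ c2 \<gamma> * q ^ c1 \<gamma> * \<Phi> (plus_comp \<gamma>)) =
    overlap_prod q \<Phi> \<alpha> \<beta>"
proof -
  have "(\<Sum>\<gamma>\<in>two_way_overlapping_shuffles \<alpha> \<beta>. (- 1) ^ c2 \<gamma> * q ^ c1 \<gamma> * \<Phi> (plus_comp \<gamma>)) =
      (\<Sum>w\<in>tagged_shuffles \<alpha> \<beta>. \<Sum>s\<in>separators w. sep_weight q s * \<Phi> (add_up (map val w) s))"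
    unfolding two_way_overlapping_shuffles_Sigma
    by (subst sum.Sigma)
      (auto simp: finite_separators tagged_shuffles_def sep_weight_def c1_def c2_def plus_comp_def
          intro!: sum.cong)
  then show ?thesis by (simp add: sum_separators overlap_prod_def)
qed

lemma coarsenings_Nil [simp]: "coarsenings [] = {[]}"
  by (auto simp: coarsenings_def) (metis list.set_intros(1) neq_Nil_conv)

lemma coarsenings_singleton [simp]: "coarsenings [x] = {[x]}"
proof (intro equalityI subsetI)
  fix \<beta> assume "\<beta> \<in> coarsenings [x]"
  then obtain bs where bs: "\<beta> = map sum_list bs" "concat bs = [x]" "[] \<notin> set bs"
    by (auto simp: coarsenings_def)
  then obtain b bs' where b: "bs = b # bs'" "b \<noteq> []" by (cases bs) auto
  with bs have "b = [x]" "concat bs' = []" by (auto simp: append_eq_Cons_conv)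
  moreover from this bs b have "bs' = []" by (cases bs') auto
  ultimately show "\<beta> \<in> {[x]}" using bs b by simp
next
  fix \<beta> assume "\<beta> \<in> {[x]}"
  then show "\<beta> \<in> coarsenings [x]" by (auto simp: coarsenings_def intro!: exI[of _ "[[x]]"])
qed

text \<open>
  This bound distinguishes the coarsenings that keep the first comma from those that replace it,
  as long as all parts are positive.
\<close>

lemma hd_coarsening:
  assumes "\<beta> \<in> coarsenings (x # w)"
  obtains b \<beta>' where "\<beta> = b # \<beta>'" "x \<le> b"
proof -
  obtain bs where bs: "\<beta> = map sum_list bs" "concat bs = x # w" "[] \<notin> set bs"
    using assms by (auto simp: coarsenings_def)
  then obtain b bs' where b: "bs = b # bs'" "b \<noteq> []" by (cases bs) auto
  with bs obtain b' where "b = x # b'" by (cases b) auto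
  then show thesis using that bs b by simp
qed

lemma coarsenings_Cons2:
  "coarsenings (x # y # w) = (#) x ` coarsenings (y # w) \<union> coarsenings ((x + y) # w)"
proof (intro equalityI subsetI)
  fix \<beta> assume "\<beta> \<in> coarsenings (x # y # w)"
  then obtain bs where bs: "\<beta> = map sum_list bs" "concat bs = x # y # w" "[] \<notin> set bs"
    by (auto simp: coarsenings_def)
  then obtain b bs' where b: "bs = b # bs'" "b \<noteq> []" by (cases bs) auto
  with bs obtain b' where b': "b = x # b'" by (cases b) auto
  show "\<beta> \<in> (#) x ` coarsenings (y # w) \<union> coarsenings ((x + y) # w)"
  proof (cases b')
    case Nil
    then have "map sum_list bs' \<in> coarsenings (y # w)"
      using bs b b' by (auto simp: coarsenings_def)
    then show ?thesis using bs b b' Nil by simp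
  next
    case (Cons z b'')
    then have "map sum_list (((x + y) # b'') # bs') \<in> coarsenings ((x + y) # w)"
      using bs b b' unfolding coarsenings_def
      by (intro CollectI exI[of _ "((x + y) # b'') # bs'"]) auto
    then show ?thesis using bs b b' Cons by (simp add: add.assoc)
  qed
next
  fix \<beta> assume "\<beta> \<in> (#) x ` coarsenings (y # w) \<union> coarsenings ((x + y) # w)"
  then consider (split) \<beta>' where "\<beta> = x # \<beta>'" "\<beta>' \<in> coarsenings (y # w)"
    | (join) "\<beta> \<in> coarsenings ((x + y) # w)" by auto
  then show "\<beta> \<in> coarsenings (x # y # w)"
  proof cases
    case split
    then obtain bs where "\<beta>' = map sum_list bs" "concat bs = y # w" "[] \<notin> set bs"
      by (auto simp: coarsenings_def)
    with split show ?thesis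
      unfolding coarsenings_def by (intro CollectI exI[of _ "[x] # bs"]) auto
  next
    case join
    then obtain bs where bs: "\<beta> = map sum_list bs" "concat bs = (x + y) # w" "[] \<notin> set bs"
      by (auto simp: coarsenings_def)
    then obtain b bs' where b: "bs = b # bs'" "b \<noteq> []" by (cases bs) auto
    with bs obtain b' where b': "b = (x + y) # b'" by (cases b) auto
    with bs b show ?thesis
      unfolding coarsenings_def
      by (intro CollectI exI[of _ "(x # y # b') # bs'"]) (auto simp: add.assoc)
  qed
qed

text \<open>
  Positivity of the parts is essential: for \<open>\<alpha> = [0, 0, 0]\<close>, say, different sets of commas produce
  the same coarsening, which the left-hand side counts once.
\<close>

lemma sum_coarsenings:
  assumes "is_composition \<alpha>"
  shows "(\<Sum>\<beta>\<in>coarsenings \<alpha>. F \<beta>) = merge_sum (\<lambda>_ _. 1) F (map Inl \<alpha>)"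
  using assms
proof (induction \<alpha> arbitrary: F rule: length_induct)
  case (1 \<alpha>)
  show ?case
  proof (cases \<alpha> rule: remdups_adj.cases)
    case (3 x y w)
    have "(#) x ` coarsenings (y # w) \<inter> coarsenings ((x + y) # w) = {}"
      using "1.prems" 3 by (fastforce simp: is_composition_def elim!: hd_coarsening)
    then have "(\<Sum>\<beta>\<in>coarsenings \<alpha>. F \<beta>) =
        (\<Sum>\<beta>\<in>coarsenings (y # w). F (x # \<beta>)) + (\<Sum>\<beta>\<in>coarsenings ((x + y) # w). F \<beta>)"
      by (simp add: 3 coarsenings_Cons2 sum.union_disjoint sum.reindex inj_on_def)
    then show ?thesis using 1 3 by (simp add: is_composition_def)
  qed simp_all
qed


section \<open>Truncation to finitely many variables\<close>

definition mfps_const :: "'a::comm_ring_1 \<Rightarrow> 'a mfps" where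
  "mfps_const c = mfps_scale c 1"

lemma mfps_nth_mult: "mfps_nth (f * g) m = (\<Sum>(a, b)\<in>splittings m. mfps_nth f a * mfps_nth g b)"
  by transfer simp

lemma mfps_nth_sum: "mfps_nth (\<Sum>x\<in>A. f x) m = (\<Sum>x\<in>A. mfps_nth (f x) m)"
  by (induction A rule: infinite_finite_induct) (simp_all add: zero_mfps.rep_eq plus_mfps.rep_eq)

lemma mfps_scale_scale: "mfps_scale a (mfps_scale b f) = mfps_scale (a * b) f"
  by transfer (simp add: ac_simps)

lemma mfps_scale_mult_left: "mfps_scale c f * g = mfps_scale c (f * g)"
  by transfer (simp add: sum_distrib_left case_prod_unfold ac_simps)

lemma mfps_const_mult_eq_scale: "mfps_const c * f = mfps_scale c f"
  by (simp add: mfps_const_def mfps_scale_mult_left)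

lemma mfps_const_mult: "mfps_const (a * b) = mfps_const a * mfps_const b"
  by (simp add: mfps_const_mult_eq_scale) (simp add: mfps_const_def mfps_scale_scale)

lemma mfps_const_1 [simp]: "mfps_const 1 = 1"
  unfolding mfps_const_def by transfer simp

lemma mfps_const_add: "mfps_const (a + b) = mfps_const a + mfps_const b"
  unfolding mfps_const_def by transfer (auto simp: fun_eq_iff)

lemma mfps_const_minus: "mfps_const (- a) = - mfps_const a"
  unfolding mfps_const_def by transfer (auto simp: fun_eq_iff)

lemma mfps_const_power: "mfps_const (a ^ n) = mfps_const a ^ n"
  by (induction n) (simp_all add: mfps_const_mult)

definition mfps_monom :: "(nat \<Rightarrow>\<^sub>0 nat) \<Rightarrow> 'a::comm_ring_1 mfps" where
  "mfps_monom m = Abs_mfps (\<lambda>m'. if m' = m then 1 else 0)"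

lemma mfps_nth_monom: "mfps_nth (mfps_monom m) m' = (if m' = m then 1 else 0)"
  by (simp add: mfps_monom_def Abs_mfps_inverse)

lemma mfps_monom_add: "mfps_monom (a + b) = mfps_monom a * mfps_monom b"
proof (rule mfps_eqI)
  fix m
  have "mfps_nth (mfps_monom a * mfps_monom b) m =
      (\<Sum>x\<in>splittings m. if x = (a, b) then 1 else 0)"
    unfolding mfps_nth_mult by (rule sum.cong) (auto simp: mfps_nth_monom split: if_splits)
  also have "\<dots> = mfps_nth (mfps_monom (a + b)) m"
    by (simp add: sum.delta mfps_nth_monom) (auto simp: splittings_def)
  finally show "mfps_nth (mfps_monom (a + b)) m = mfps_nth (mfps_monom a * mfps_monom b) m" ..
qed

lemma mfps_monom_0 [simp]: "mfps_monom 0 = 1"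
  by (rule mfps_eqI) (simp add: mfps_nth_monom one_mfps.rep_eq)

definition index_seqs :: "nat \<Rightarrow> nat \<Rightarrow> nat list set" where
  "index_seqs n l = {is. length is = l \<and> sorted_wrt (<) is \<and> set is \<subseteq> {..<n}}"

definition exponents :: "nat list \<Rightarrow> nat list \<Rightarrow> (nat \<Rightarrow>\<^sub>0 nat)" where
  "exponents \<beta> is = (\<Sum>k<length \<beta>. Poly_Mapping.single (is ! k) (\<beta> ! k))"

definition trunc_monomial_qsym :: "nat \<Rightarrow> nat list \<Rightarrow> 'a::comm_ring_1 mfps" where
  "trunc_monomial_qsym n \<beta> = (\<Sum>is\<in>index_seqs n (length \<beta>). mfps_monom (exponents \<beta> is))"

lemma finite_index_seqs [simp]: "finite (index_seqs n l)"
  by (rule finite_subset[OF _ finite_lists_length_eq[of "{..<n}" l]]) (auto simp: index_seqs_def)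

lemma index_seqs_0 [simp]: "index_seqs n 0 = {[]}"
  by (auto simp: index_seqs_def)

lemma index_seqs_Suc_Suc:
  "index_seqs (Suc n) (Suc l) = index_seqs n (Suc l) \<union> (\<lambda>is. is @ [n]) ` index_seqs n l"
proof (intro equalityI subsetI)
  fix "is" assume "is": "is \<in> index_seqs (Suc n) (Suc l)"
  then obtain js j where j: "is = js @ [j]"
    by (cases "is" rule: rev_cases) (auto simp: index_seqs_def)
  show "is \<in> index_seqs n (Suc l) \<union> (\<lambda>is. is @ [n]) ` index_seqs n l"
  proof (cases "j = n")
    case True
    then show ?thesis using "is" j by (auto simp: index_seqs_def sorted_wrt_append)
  next
    case False
    then show ?thesis using "is" j by (fastforce simp: index_seqs_def sorted_wrt_append)
  qed
next
  fix "is" assume "is \<in> index_seqs n (Suc l) \<union> (\<lambda>is. is @ [n]) ` index_seqs n l"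
  then show "is \<in> index_seqs (Suc n) (Suc l)"
    by (auto simp: index_seqs_def sorted_wrt_append less_Suc_eq)
qed

lemma trunc_monomial_qsym_Nil [simp]: "trunc_monomial_qsym n [] = 1"
  by (simp add: trunc_monomial_qsym_def exponents_def)

lemma trunc_monomial_qsym_0: "trunc_monomial_qsym 0 \<beta> = (if \<beta> = [] then 1 else 0)"
proof (cases "\<beta> = []")
  case False
  then have "index_seqs 0 (length \<beta>) = {}" by (auto simp: index_seqs_def)
  with False show ?thesis by (simp add: trunc_monomial_qsym_def)
qed simp

text \<open>
  The variable \<open>x\<^sub>n\<close> is either absent or carries the last exponent.
\<close>

lemma trunc_monomial_qsym_snoc:
  "trunc_monomial_qsym (Suc n) (\<beta> @ [a]) =
    trunc_monomial_qsym n (\<beta> @ [a])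
    + trunc_monomial_qsym n \<beta> * mfps_monom (Poly_Mapping.single n a)"
proof -
  have disj: "index_seqs n (Suc (length \<beta>)) \<inter> (\<lambda>is. is @ [n]) ` index_seqs n (length \<beta>) = {}"
    by (auto simp: index_seqs_def)
  have snoc: "exponents (\<beta> @ [a]) (is @ [n]) = exponents \<beta> is + Poly_Mapping.single n a"
    if "is \<in> index_seqs n (length \<beta>)" for "is"
    using that by (auto simp: exponents_def index_seqs_def nth_append)
  have "trunc_monomial_qsym (Suc n) (\<beta> @ [a]) = trunc_monomial_qsym n (\<beta> @ [a])
      + (\<Sum>is\<in>index_seqs n (length \<beta>). mfps_monom (exponents (\<beta> @ [a]) (is @ [n])) :: 'a mfps)"
    by (simp add: trunc_monomial_qsym_def index_seqs_Suc_Suc sum.union_disjoint[OF _ _ disj]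
        sum.reindex inj_on_def)
  also have "(\<Sum>is\<in>index_seqs n (length \<beta>). mfps_monom (exponents (\<beta> @ [a]) (is @ [n])) :: 'a mfps)
      = trunc_monomial_qsym n \<beta> * mfps_monom (Poly_Mapping.single n a)"
    by (simp add: trunc_monomial_qsym_def sum_distrib_right mfps_monom_add snoc)
  finally show ?thesis .
qed

text \<open>
  Every index of a sequence is visible in its monomial, because the exponent there is positive.
  Hence a monomial in the first \<open>n\<close> variables comes from index sequences below \<open>n\<close> only.
\<close>

lemma index_seq_in_keys:
  assumes "is_composition \<beta>" and "length is = length \<beta>"
  shows "set is \<subseteq> Poly_Mapping.keys (exponents \<beta> is)"
proof
  fix i assume "i \<in> set is"
  then obtain k where k: "k < length \<beta>" "is ! k = i"
    using assms(2) by (auto simp: in_set_conv_nth)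
  have "0 < \<beta> ! k" using assms(1) k by (simp add: is_composition_def)
  also have "\<beta> ! k \<le> (\<Sum>k<length \<beta>. Poly_Mapping.lookup (Poly_Mapping.single (is ! k) (\<beta> ! k)) i)"
    using k member_le_sum[of k "{..<length \<beta>}"
        "\<lambda>k. Poly_Mapping.lookup (Poly_Mapping.single (is ! k) (\<beta> ! k)) i"] by simp
  finally have "0 < Poly_Mapping.lookup (exponents \<beta> is) i"
    by (simp add: exponents_def lookup_sum)
  then show "i \<in> Poly_Mapping.keys (exponents \<beta> is)" by (simp add: in_keys_iff)
qed

lemma mfps_nth_trunc_monomial_qsym:
  assumes "is_composition \<beta>" and "Poly_Mapping.keys m \<subseteq> {..<n}"
  shows "mfps_nth (trunc_monomial_qsym n \<beta>) m = mfps_nth (monomial_qsym \<beta> :: 'a::comm_ring_1 mfps) m"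
proof -
  have "{is. length is = length \<beta> \<and> sorted_wrt (<) is \<and> exponents \<beta> is = m} =
      {is \<in> index_seqs n (length \<beta>). m = exponents \<beta> is}"
    using index_seq_in_keys[OF assms(1)] assms(2) by (fastforce simp: index_seqs_def)
  then have "mfps_nth (monomial_qsym \<beta> :: 'a mfps) m =
      of_nat (card {is \<in> index_seqs n (length \<beta>). m = exponents \<beta> is})"
    by (simp add: monomial_qsym_def Abs_mfps_inverse exponents_def[symmetric])
  also have "\<dots> = (\<Sum>is\<in>index_seqs n (length \<beta>). if m = exponents \<beta> is then 1 else 0)"
    by (simp add: sum.If_cases Int_def)
  also have "\<dots> = mfps_nth (trunc_monomial_qsym n \<beta>) m"
    by (simp add: trunc_monomial_qsym_def mfps_nth_sum mfps_nth_monom)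
  finally show ?thesis ..
qed


section \<open>The product rule for an arbitrary parameter\<close>

text \<open>
  The common generalization of \<open>eta\<close> and \<open>eta_q\<close>.
\<close>

definition enriched :: "'a::comm_ring_1 \<Rightarrow> nat list \<Rightarrow> 'a mfps" where
  "enriched q \<alpha> = (\<Sum>\<beta>\<in>coarsenings \<alpha>. mfps_scale ((q + 1) ^ length \<beta>) (monomial_qsym \<beta>))"

definition weighted_trunc :: "'a::comm_ring_1 \<Rightarrow> nat \<Rightarrow> nat list \<Rightarrow> 'a mfps" where
  "weighted_trunc q n \<beta> = (mfps_const q + 1) ^ length \<beta> * trunc_monomial_qsym n \<beta>"

text \<open>
  The enriched function in the variables below \<open>n\<close>. It is written as a \<open>merge_sum\<close> and not as a
  sum over coarsenings, because the two may differ on lists with entries zero, and the form below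
  satisfies its recursion in \<open>n\<close> on all lists. Tagging all letters by \<open>Inl\<close> is arbitrary, as the
  weight is constant.
\<close>

definition trunc_enriched :: "'a::comm_ring_1 \<Rightarrow> nat \<Rightarrow> nat list \<Rightarrow> 'a mfps" where
  "trunc_enriched q n \<alpha> = merge_sum (\<lambda>_ _. 1) (weighted_trunc q n) (map Inl \<alpha>)"

text \<open>
  For \<open>r = q + 1\<close>, the monomial quasisymmetric function in a single variable, weighted by a
  factor \<open>r\<close> for each part.
\<close>

definition one_letter :: "'r::comm_ring_1 \<Rightarrow> (nat \<Rightarrow> 'r) \<Rightarrow> nat list \<Rightarrow> 'r" where
  "one_letter r X l = (case l of [] \<Rightarrow> 1 | [a] \<Rightarrow> r * X a | _ \<Rightarrow> 0)"

lemma merge_sum_one_letter: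
  "merge_sum (\<lambda>_ _. 1) (one_letter r X) (map Inl \<alpha>) = one_var r X \<alpha>"
proof (induction \<alpha> rule: length_induct)
  case (1 \<alpha>)
  show ?case
  proof (cases \<alpha> rule: remdups_adj.cases)
    case (3 x y w)
    have "merge_sum (\<lambda>_ _. 1) (\<lambda>l. one_letter r X (x # l)) (map Inl (y # w)) =
        merge_sum (\<lambda>_ _. 1) (\<lambda>_. 0) (map Inl (y # w))"
      by (intro merge_sum_cong_nonempty) (auto simp: one_letter_def split: list.split)
    then show ?thesis
      using 1[rule_format, of "(x + y) # w"] 3 by (simp add: one_var_def ac_simps)
  qed (simp_all add: one_letter_def one_var_def)
qed

lemma deconc_conv_one_letter_snoc:
  "deconc_conv A (one_letter r X) (\<beta> @ [a]) = A (\<beta> @ [a]) + A \<beta> * (r * X a)"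
proof (induction \<beta> arbitrary: A)
  case Nil
  show ?case by (simp add: deconc_conv_Cons one_letter_def)
next
  case (Cons b \<beta>)
  have "one_letter r X (b # \<beta> @ [a]) = 0"
    by (cases \<beta>) (simp_all add: one_letter_def)
  then show ?case by (simp add: deconc_conv_Cons Cons)
qed

lemma weighted_trunc_Suc:
  "weighted_trunc q (Suc n) = deconc_conv (weighted_trunc q n)
     (one_letter (mfps_const q + 1) (\<lambda>a. mfps_monom (Poly_Mapping.single n a)))"
proof
  fix \<beta> :: "nat list"
  show "weighted_trunc q (Suc n) \<beta> = deconc_conv (weighted_trunc q n)
     (one_letter (mfps_const q + 1) (\<lambda>a. mfps_monom (Poly_Mapping.single n a))) \<beta>"
  proof (cases \<beta> rule: rev_cases)
    case Nil
    then show ?thesis by (simp add: weighted_trunc_def one_letter_def)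
  next
    case (snoc \<gamma> a)
    then show ?thesis
      by (simp add: deconc_conv_one_letter_snoc)
        (simp add: weighted_trunc_def trunc_monomial_qsym_snoc distrib_left ac_simps)
  qed
qed

text \<open>
  The weighted monomial functions satisfy such a recursion by \<open>trunc_monomial_qsym_snoc\<close>, and
  summing over coarsenings respects convolutions by \<open>merge_sum_deconc_conv\<close>.
\<close>

lemma trunc_enriched_Suc:
  "trunc_enriched q (Suc n) = deconc_conv (trunc_enriched q n)
     (one_var (mfps_const q + 1) (\<lambda>a. mfps_monom (Poly_Mapping.single n a)))"
  by (rule ext, simp only: trunc_enriched_def weighted_trunc_Suc merge_sum_deconc_conv)
    (simp add: deconc_conv_def take_map drop_map trunc_enriched_def merge_sum_one_letter)

lemma is_character_trunc_enriched: "is_character (mfps_const q) (trunc_enriched q n)"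
proof (induction n)
  case 0
  have W: "weighted_trunc q 0 = (\<lambda>l. if l = [] then 1 else 0)"
    by (auto simp: weighted_trunc_def trunc_monomial_qsym_0)
  have "trunc_enriched q 0 = (\<lambda>l. if l = [] then 1 else 0)"
    by (rule ext) (simp add: trunc_enriched_def W merge_sum_counit)
  then show ?case by (simp add: is_character_counit)
next
  case (Suc n)
  show ?case
    unfolding trunc_enriched_Suc
    by (intro is_character_deconc_conv Suc is_character_one_var)
      (simp add: single_add mfps_monom_add)
qed

lemma is_composition_coarsening:
  assumes "is_composition \<alpha>" and "\<beta> \<in> coarsenings \<alpha>"
  shows "is_composition \<beta>"
proof -
  obtain bs where bs: "\<beta> = map sum_list bs" "concat bs = \<alpha>" "[] \<notin> set bs"
    using assms(2) by (auto simp: coarsenings_def)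
  have "0 < sum_list b" if "b \<in> set bs" for b
  proof -
    have "b \<noteq> []" using bs(3) that by blast
    then have hd: "hd b \<in> set b" by (rule hd_in_set)
    then have "hd b \<in> set \<alpha>" unfolding bs(2)[symmetric] set_concat using that by blast
    then have "0 < hd b" using assms(1) by (simp add: is_composition_def)
    also have "hd b \<le> sum_list b" using hd by (simp add: member_le_sum_list)
    finally show ?thesis .
  qed
  then show ?thesis by (auto simp: is_composition_def bs)
qed

lemma mfps_nth_trunc_enriched:
  assumes "is_composition \<alpha>" and "Poly_Mapping.keys m \<subseteq> {..<n}"
  shows "mfps_nth (trunc_enriched q n \<alpha>) m = mfps_nth (enriched q \<alpha>) m"
proof -
  have "trunc_enriched q n \<alpha> = (\<Sum>\<beta>\<in>coarsenings \<alpha>. weighted_trunc q n \<beta>)"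
    by (simp add: trunc_enriched_def sum_coarsenings[OF assms(1)])
  also have "\<dots> = (\<Sum>\<beta>\<in>coarsenings \<alpha>. mfps_scale ((q + 1) ^ length \<beta>) (trunc_monomial_qsym n \<beta>))"
    by (simp add: weighted_trunc_def mfps_const_mult_eq_scale[symmetric] mfps_const_power
        mfps_const_add)
  finally show ?thesis
    by (simp add: enriched_def mfps_nth_sum mfps_scale.rep_eq
        mfps_nth_trunc_monomial_qsym[OF is_composition_coarsening[OF assms(1)] assms(2)])
qed

lemma keys_splitting:
  assumes "(a, b) \<in> splittings m"
  shows "Poly_Mapping.keys a \<subseteq> Poly_Mapping.keys m" and "Poly_Mapping.keys b \<subseteq> Poly_Mapping.keys m"
  using assms by (auto simp: splittings_def in_keys_iff lookup_add)

lemma is_composition_iff: "is_composition l \<longleftrightarrow> 0 \<notin> set l"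
  by (metis is_composition_def neq0_conv)

lemma is_composition_add_up: "is_composition l \<Longrightarrow> is_composition (add_up l s)"
  unfolding is_composition_iff by (induction l s rule: add_up.induct) simp_all

lemma is_composition_plus_comp:
  assumes "is_composition \<alpha>" and "is_composition \<beta>"
    and "\<gamma> \<in> two_way_overlapping_shuffles \<alpha> \<beta>"
  shows "is_composition (plus_comp \<gamma>)"
proof -
  have "set (fst \<gamma>) = Inl ` set \<alpha> \<union> Inr ` set \<beta>"
    using assms(3) set_shuffles[of "fst \<gamma>" "map Inl \<alpha>" "map Inr \<beta>"]
    by (auto simp: two_way_overlapping_shuffles_def tagged_shuffles_def)
  then have "is_composition (map val (fst \<gamma>))"
    using assms(1,2) by (auto simp: is_composition_def)
  then show ?thesis by (simp add: plus_comp_def is_composition_add_up)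
qed

text \<open>
  Both sides are compared at one monomial \<open>m\<close>. All divisors of \<open>m\<close> live in the variables that occur
  in \<open>m\<close>, so every series involved may be replaced by its truncation to the first \<open>n\<close> variables if
  these include the variables of \<open>m\<close>.
\<close>

theorem enriched_mult:
  assumes "is_composition \<alpha>" and "is_composition \<beta>"
  shows "enriched q \<alpha> * enriched q \<beta> =
    (\<Sum>\<gamma>\<in>two_way_overlapping_shuffles \<alpha> \<beta>.
       mfps_scale ((- 1) ^ c2 \<gamma> * q ^ c1 \<gamma>) (enriched q (plus_comp \<gamma>)))"
proof (rule mfps_eqI)
  fix m :: "nat \<Rightarrow>\<^sub>0 nat"
  let ?I = "two_way_overlapping_shuffles \<alpha> \<beta>"
  have "finite (Poly_Mapping.keys m)" by simp
  then obtain n where n: "Poly_Mapping.keys m \<subseteq> {..<n}"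
    using finite_nat_set_iff_bounded[of "Poly_Mapping.keys m"] by auto
  have "mfps_nth (enriched q \<alpha> * enriched q \<beta>) m =
      mfps_nth (trunc_enriched q n \<alpha> * trunc_enriched q n \<beta>) m"
    unfolding mfps_nth_mult
  proof (intro sum.cong refl, clarify)
    fix a b assume "(a, b) \<in> splittings m"
    then have "Poly_Mapping.keys a \<subseteq> {..<n}" "Poly_Mapping.keys b \<subseteq> {..<n}"
      using keys_splitting n by blast+
    then show "mfps_nth (enriched q \<alpha>) a * mfps_nth (enriched q \<beta>) b =
        mfps_nth (trunc_enriched q n \<alpha>) a * mfps_nth (trunc_enriched q n \<beta>) b"
      using assms by (simp add: mfps_nth_trunc_enriched)
  qed
  also have "trunc_enriched q n \<alpha> * trunc_enriched q n \<beta> =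
      overlap_prod (mfps_const q) (trunc_enriched q n) \<alpha> \<beta>"
    using is_character_trunc_enriched[of q n] by (simp add: is_character_def)
  also have "\<dots> = (\<Sum>\<gamma>\<in>?I.
      mfps_scale ((- 1) ^ c2 \<gamma> * q ^ c1 \<gamma>) (trunc_enriched q n (plus_comp \<gamma>)))"
    by (simp add: sum_two_way_overlapping_shuffles[symmetric] mfps_const_mult_eq_scale[symmetric]
        mfps_const_mult mfps_const_power mfps_const_minus)
  also have "mfps_nth \<dots> m = mfps_nth (\<Sum>\<gamma>\<in>?I.
      mfps_scale ((- 1) ^ c2 \<gamma> * q ^ c1 \<gamma>) (enriched q (plus_comp \<gamma>))) m"
    using is_composition_plus_comp[OF assms] n
    by (simp add: mfps_nth_sum mfps_scale.rep_eq mfps_nth_trunc_enriched)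
  finally show "mfps_nth (enriched q \<alpha> * enriched q \<beta>) m = mfps_nth (\<Sum>\<gamma>\<in>?I.
      mfps_scale ((- 1) ^ c2 \<gamma> * q ^ c1 \<gamma>) (enriched q (plus_comp \<gamma>))) m" .
qed

lemma eta_eq_enriched: "eta = enriched 1"
  by (simp add: eta_def enriched_def fun_eq_iff)

lemma eta_q_eq_enriched: "eta_q = enriched qvar"
  by (simp add: eta_q_def enriched_def fun_eq_iff)

theorem corollary4p10:
  fixes \<alpha> \<beta> :: "nat list"
  assumes "is_composition \<alpha>" and "is_composition \<beta>"
  shows "(eta \<alpha> * eta \<beta> :: 'a::comm_ring_1 mfps) =
      (\<Sum>\<gamma>\<in>two_way_overlapping_shuffles \<alpha> \<beta>. mfps_scale ((-1) ^ c2 \<gamma>) (eta (plus_comp \<gamma>)))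
    \<and> eta_q \<alpha> * eta_q \<beta> =
      (\<Sum>\<gamma>\<in>two_way_overlapping_shuffles \<alpha> \<beta>.
         mfps_scale ((-1) ^ c2 \<gamma> * qvar ^ c1 \<gamma>) (eta_q (plus_comp \<gamma>)))"
  using enriched_mult[OF assms, of "1::'a"] enriched_mult[OF assms, of qvar]
  by (simp add: eta_eq_enriched eta_q_eq_enriched)

end
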